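(* There exists an absolute constant $\kappa>0$ such that for every $m\ge \kappa n\log n$, the Packing process satisfies \[ \Pr\Big[\mathrm{Gap}(m)\ge \tfrac{\sqrt{\kappa}}{20}\log n\Big]\ge \tfrac12 . \]
   Context: There are $n$ bins with loads $x^t\in\mathbb{Z}_{\ge0}^n$ after $t$ rounds, $x^0=(0,\dots,0)$, $W^t=\sum_i x_i^t$, and $\mathrm{Gap}(t)=\max_i x_i^t-W^t/n$. The Packing process: in each round $t\ge0$, sample a bin $i$ uniformly at random (independently of the past) and set $x_i^{t+1}=x_i^t+1$ if $x_i^t\ge W^t/n$, and $x_i^{t+1}=\lceil W^t/n\rceil+1$ if $x_i^t<W^t/n$; other loads are unchanged. Convention: statements are asserted for all sufficiently large $n$. *)

theory Defs
  imports "HOL-Probability.Probability"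
begin

text \<open>
  Bins are indexed by \<open>{..<n}\<close>, and a load vector is a function \<open>nat \<Rightarrow> nat\<close>
  of which only the values below \<open>n\<close> matter.
\<close>

definition total_load :: "nat \<Rightarrow> (nat \<Rightarrow> nat) \<Rightarrow> nat" where
  "total_load n x = (\<Sum>i<n. x i)"

definition avg_load :: "nat \<Rightarrow> (nat \<Rightarrow> nat) \<Rightarrow> real" where
  "avg_load n x = real (total_load n x) / real n"

definition gap :: "nat \<Rightarrow> (nat \<Rightarrow> nat) \<Rightarrow> real" where
  "gap n x = real (Max (x ` {..<n})) - avg_load n x"

definition packing_step :: "nat \<Rightarrow> (nat \<Rightarrow> nat) \<Rightarrow> nat \<Rightarrow> (nat \<Rightarrow> nat)" where
  "packing_step n x i =
     x(i := if real (x i) \<ge> avg_load n x then x i + 1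
            else nat \<lceil>avg_load n x\<rceil> + 1)"

text \<open>
  \<open>packing n t\<close> is the law of the load vector after \<open>t\<close> rounds. In each round the bin is drawn
  uniformly and independently of the current load vector. For \<open>n = 0\<close> the law is meaningless
  after round 0.
\<close>

primrec packing :: "nat \<Rightarrow> nat \<Rightarrow> (nat \<Rightarrow> nat) pmf" where
  "packing n 0 = return_pmf (\<lambda>_. 0)"
| "packing n (Suc t) =
     packing n t \<bind> (\<lambda>x. map_pmf (packing_step n x) (pmf_of_set {..<n}))"

end

theory Submission
  imports Defs "HOL-Real_Asymp.Real_Asymp"
begin

text \<open>
  In a window of \<open>\<kappa> n ln n\<close> rounds some bin is hit at least \<open>(sqrt \<kappa> / 4) ln n\<close> times, and
  every hit bin ends above the average at the beginning of the window by at least its number of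
  hits. It therefore suffices that the average rises by only \<open>O(\<kappa> ln n)\<close> during the window;
  for small \<open>\<kappa>\<close> this is negligible compared to \<open>sqrt \<kappa> ln n\<close>. In expectation, the
  average rises by at most \<open>(2 + D / n) / n\<close> per round, where \<open>D\<close> is the total overload,
  and \<open>D = O(n)\<close> in expectation at any time follows from a Lyapunov function: an exponential
  potential times a bounded factor that measures how many bins are close to or below the average.
\<close>

section \<open>Effect of one round\<close>

definition dev :: "nat \<Rightarrow> (nat \<Rightarrow> nat) \<Rightarrow> nat \<Rightarrow> real" where
  "dev n x i = real (x i) - avg_load n x"

definition gain :: "nat \<Rightarrow> (nat \<Rightarrow> nat) \<Rightarrow> nat \<Rightarrow> real" where
  "gain n x j = real (packing_step n x j j) - real (x j)"

lemma sum_dev: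
  assumes "n > 0"
  shows "(\<Sum>i<n. dev n x i) = 0"
  using assms by (simp add: dev_def sum_subtractf avg_load_def total_load_def)

lemma gain_overloaded: "dev n x j \<ge> 0 \<Longrightarrow> gain n x j = 1"
  by (simp add: gain_def dev_def packing_step_def)

lemma gain_underloaded:
  assumes "dev n x j < 0"
  shows "gain n x j \<ge> 2" "gain n x j \<ge> 1 - dev n x j" "gain n x j \<le> 2 - dev n x j"
proof -
  have "avg_load n x > real (x j)" using assms by (simp add: dev_def)
  then have c: "\<lceil>avg_load n x\<rceil> \<ge> int (x j) + 1" by linarith
  then have "\<lceil>avg_load n x\<rceil> \<ge> 0" by linarith
  then have r: "real (nat \<lceil>avg_load n x\<rceil>) = real_of_int \<lceil>avg_load n x\<rceil>" by simp
  have g: "gain n x j = real_of_int \<lceil>avg_load n x\<rceil> + 1 - real (x j)"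
    using assms r by (simp add: gain_def packing_step_def dev_def)
  show "gain n x j \<ge> 2" using c g by linarith
  show "gain n x j \<ge> 1 - dev n x j" "gain n x j \<le> 2 - dev n x j"
    unfolding g dev_def by linarith+
qed

lemma gain_ge_1: "gain n x j \<ge> 1"
  using gain_overloaded[of n x j] gain_underloaded(1)[of n x j] by linarith

lemma packing_step_eq: "real (packing_step n x j i) = real (x i) + (if i = j then gain n x j else 0)"
  by (simp add: gain_def) (simp add: packing_step_def)

lemma avg_load_packing_step:
  assumes "j < n"
  shows "avg_load n (packing_step n x j) = avg_load n x + gain n x j / n"
proof -
  have "real (total_load n (packing_step n x j)) = real (total_load n x) + gain n x j"
    using assms by (simp add: total_load_def packing_step_eq sum.distrib)
  then show ?thesis by (simp add: avg_load_def add_divide_distrib)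
qed

lemma dev_packing_step:
  assumes "j < n"
  shows "dev n (packing_step n x j) i = dev n x i + (if i = j then gain n x j else 0) - gain n x j / n"
  by (simp add: dev_def packing_step_eq avg_load_packing_step[OF assms])

section \<open>Exponential potential and its change in one round\<close>

definition exp_pot :: "real \<Rightarrow> nat \<Rightarrow> (nat \<Rightarrow> nat) \<Rightarrow> real" where
  "exp_pot a n x = (\<Sum>i<n. exp (a * dev n x i))"

text \<open>The rise of the average scales all summands by one common factor; apart from that only
  bin \<open>j\<close> changes.\<close>

lemma exp_pot_packing_step:
  assumes "j < n"
  shows "exp_pot a n (packing_step n x j) =
    exp (- (a * gain n x j / n)) * (exp_pot a n x + exp (a * dev n x j) * (exp (a * gain n x j) - 1))"
proof -
  have "exp (a * dev n (packing_step n x j) i) = exp (- (a * gain n x j / n)) *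
     (exp (a * dev n x i) + (if i = j then exp (a * dev n x j) * (exp (a * gain n x j) - 1) else 0))" for i
    by (auto simp: dev_packing_step[OF assms] algebra_simps simp flip: exp_add)
  then show ?thesis
    using assms by (simp add: exp_pot_def sum.distrib flip: sum_distrib_left)
qed

text \<open>
  The weight saturates only at \<open>-1\<close>, so that a bin exactly at the average still gains weight
  when it sinks.
\<close>
definition low_weight :: "real \<Rightarrow> real" where
  "low_weight y = exp (- max y (-1))"

definition low_pot :: "nat \<Rightarrow> (nat \<Rightarrow> nat) \<Rightarrow> real" where
  "low_pot n x = (\<Sum>i<n. low_weight (dev n x i))"

lemma low_weight_bounds: "low_weight y > 0" "low_weight y \<le> 3"
proof -
  show "low_weight y > 0" by (simp add: low_weight_def)
  have "low_weight y \<le> exp 1" by (simp add: low_weight_def)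
  then show "low_weight y \<le> 3" using exp_le by linarith
qed

lemma low_weight_antimono: "y \<le> z \<Longrightarrow> low_weight z \<le> low_weight y"
  by (simp add: low_weight_def)

lemma low_pot_bounds: "low_pot n x \<ge> 0" "low_pot n x \<le> 3 * n"
proof -
  show "low_pot n x \<ge> 0" unfolding low_pot_def
    by (intro sum_nonneg) (use low_weight_bounds in \<open>auto intro: less_imp_le\<close>)
  have "low_pot n x \<le> (\<Sum>i<n. 3)" unfolding low_pot_def
    by (intro sum_mono) (use low_weight_bounds in auto)
  then show "low_pot n x \<le> 3 * n" by simp
qed

text \<open>Minus the slope of \<open>low_weight\<close> at deviations \<ge> 0: by convexity, a
  lower bound on the weight gained per unit of sinking.\<close>

definition over_weight :: "nat \<Rightarrow> (nat \<Rightarrow> nat) \<Rightarrow> nat \<Rightarrow> real" where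
  "over_weight n x i = (if dev n x i \<ge> 0 then exp (- dev n x i) else 0)"

text \<open>Lower bound for the change of \<open>low_pot\<close> when bin \<open>j\<close> is hit.
  The first term collects the sinking of the other bins by at least \<open>1 / n\<close>, with
  \<open>- 1\<close> discounting bin \<open>j\<close>; the second bounds the loss of bin
  \<open>j\<close> itself.\<close>

definition low_drift :: "nat \<Rightarrow> (nat \<Rightarrow> nat) \<Rightarrow> nat \<Rightarrow> real" where
  "low_drift n x j = ((\<Sum>i<n. over_weight n x i) - 1) / n -
     (if dev n x j \<ge> 0 then 2/3 * over_weight n x j else 3)"

lemma over_weight_bounds: "0 \<le> over_weight n x i" "over_weight n x i \<le> 1"
  by (auto simp: over_weight_def)

lemma low_pot_packing_step:
  assumes j: "j < n"
  shows "low_pot n (packing_step n x j) \<ge> low_pot n x + low_drift n x j"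
proof -
  let ?x = "packing_step n x j"
  define loss where "loss = (if dev n x j \<ge> 0 then 2/3 * over_weight n x j else 3)"
  have n: "n \<ge> 1" using j by simp
  \<comment> \<open>Rising by at most 1 keeps at least the fraction \<open>exp (-1)\<close> of the
    weight; hence the factor \<open>2/3\<close> in the loss.\<close>
  have e3: "exp (-1::real) \<ge> 1/3" using exp_le by (simp add: exp_minus field_simps)
  \<comment> \<open>The subtracted term cancels \<open>over_weight n x j / n\<close> at
    \<open>i = j\<close>, so that the sum can run over all bins.\<close>
  have *: "low_weight (dev n ?x i) \<ge> low_weight (dev n x i) + (over_weight n x i / n - (if i = j then over_weight n x j / n + loss else 0))" for i
  proof (cases "i = j")
    case True
    show ?thesis
    proof (cases "dev n x j \<ge> 0")
      case over: True
      have "dev n ?x j \<le> dev n x j + 1"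
        using gain_overloaded[OF over] by (simp add: dev_packing_step[OF j])
      then have "low_weight (dev n x j + 1) \<le> low_weight (dev n ?x j)"
        by (rule low_weight_antimono)
      moreover have "low_weight (dev n x j + 1) = exp (- dev n x j) * exp (-1)"
        using over by (simp add: low_weight_def max_def flip: exp_add)
      moreover have "exp (- dev n x j) * exp (-1) \<ge> exp (- dev n x j) * (1/3)"
        by (rule mult_left_mono[OF e3]) simp
      moreover have "low_weight (dev n x j) = exp (- dev n x j)"
        using over by (simp add: low_weight_def max_def)
      moreover have "loss = 2/3 * exp (- dev n x j)" "over_weight n x j = exp (- dev n x j)"
        using over by (simp_all add: loss_def over_weight_def)
      ultimately show ?thesis unfolding True if_P[OF refl] by linarith
    next
      case False
      then show ?thesis using True low_weight_bounds[of "dev n ?x j"] low_weight_bounds[of "dev n x j"]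
        by (simp add: loss_def)
    qed
  next
    case False
    have "gain n x j / n \<ge> 1 / n" using gain_ge_1 by (intro divide_right_mono) auto
    then have le: "dev n ?x i \<le> dev n x i - 1 / n" using False by (simp add: dev_packing_step[OF j])
    show ?thesis
    proof (cases "dev n x i \<ge> 0")
      case True
      \<comment> \<open>From a deviation \<ge> 0, sinking by \<open>1 / n\<close> does not pass the
        saturation point \<open>-1\<close>.\<close>
      have "1 / real n \<le> 1" using n by simp
      then have "low_weight (dev n x i - 1 / n) = exp (- dev n x i) * exp (1 / n)"
        using True by (simp add: low_weight_def max_def flip: exp_add)
      moreover have "exp (- dev n x i) * exp (1 / n) \<ge> exp (- dev n x i) * (1 + 1 / n)"
        by (intro mult_left_mono) auto
      moreover have "low_weight (dev n x i) = exp (- dev n x i)"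
        using True by (simp add: low_weight_def max_def)
      ultimately show ?thesis using False True low_weight_antimono[OF le]
        by (simp add: over_weight_def algebra_simps)
    next
      case under: False
      have "dev n ?x i \<le> dev n x i" using le by (smt (verit) divide_nonneg_nonneg of_nat_0_le_iff)
      from low_weight_antimono[OF this] show ?thesis
        using under False by (simp add: over_weight_def)
    qed
  qed
  have "low_pot n ?x \<ge> (\<Sum>i<n. low_weight (dev n x i) + (over_weight n x i / n - (if i = j then over_weight n x j / n + loss else 0)))"
    unfolding low_pot_def by (intro sum_mono *)
  also have "(\<Sum>i<n. low_weight (dev n x i) + (over_weight n x i / n - (if i = j then over_weight n x j / n + loss else 0)))
     = low_pot n x + (\<Sum>i<n. over_weight n x i) / n - over_weight n x j / n - loss"
    using j by (simp add: sum.distrib sum_subtractf low_pot_def sum_divide_distrib)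
  finally have "low_pot n ?x \<ge> \<dots>" .
  moreover have "over_weight n x j / n \<le> 1 / n"
    using over_weight_bounds by (intro divide_right_mono) auto
  ultimately show ?thesis by (simp add: low_drift_def loss_def diff_divide_distrib)
qed

text \<open>The sign for underloaded bins matters later: their gain may be huge, and bounding
  \<open>- E * d\<close> by \<open>- d\<close> for a small decay factor \<open>E\<close> then relies
  on \<open>d \<le> 0\<close>.\<close>

lemma low_drift_bounds:
  assumes "j < n"
  shows "\<bar>low_drift n x j\<bar> \<le> 4" "dev n x j < 0 \<Longrightarrow> low_drift n x j \<le> 0"
proof -
  define S where "S = (\<Sum>i<n. over_weight n x i)"
  have "S \<ge> 0" unfolding S_def by (intro sum_nonneg over_weight_bounds)
  moreover have "S \<le> (\<Sum>i<n. 1)" unfolding S_def by (intro sum_mono over_weight_bounds)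
  ultimately have "(S - 1) / n \<le> 1" "(S - 1) / n \<ge> -1" using assms by (auto simp: field_simps)
  then show "\<bar>low_drift n x j\<bar> \<le> 4" "dev n x j < 0 \<Longrightarrow> low_drift n x j \<le> 0"
    using over_weight_bounds[of n x j] by (auto simp: low_drift_def S_def)
qed

section \<open>Sums over the hit bin\<close>

definition under_frac :: "nat \<Rightarrow> (nat \<Rightarrow> nat) \<Rightarrow> real" where
  "under_frac n x = (\<Sum>j<n. if dev n x j < 0 then 1 else 0) / n"

text \<open>Sinking contributes the full sum of \<open>over_weight\<close>, and the hits take back
  only two thirds of it.\<close>

lemma sum_low_drift:
  assumes "n > 0"
  shows "(\<Sum>j<n. low_drift n x j) \<ge> (\<Sum>j<n. over_weight n x j) / 3 - 1 - 3 * n * under_frac n x"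
proof -
  define S where "S = (\<Sum>i<n. over_weight n x i)"
  have "(\<Sum>j<n. low_drift n x j) =
    (\<Sum>j<n. (S - 1) / n - (2/3 * over_weight n x j + 3 * (if dev n x j < 0 then 1 else 0)))"
    unfolding low_drift_def S_def by (intro sum.cong) (auto simp: over_weight_def)
  also have "\<dots> = (S - 1) - (2/3 * S + 3 * n * under_frac n x)"
    using assms unfolding sum_subtractf sum.distrib sum_distrib_left[symmetric]
    by (simp add: S_def under_frac_def)
  finally show ?thesis by (simp add: S_def)
qed

definition overload :: "nat \<Rightarrow> (nat \<Rightarrow> nat) \<Rightarrow> real" where
  "overload n x = (\<Sum>i<n. max 0 (dev n x i))"

lemma overload_eq_underload:
  assumes "n > 0"
  shows "overload n x = (\<Sum>i<n. max 0 (- dev n x i))"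
proof -
  have "overload n x = (\<Sum>i<n. dev n x i + max 0 (- dev n x i))"
    unfolding overload_def by (intro sum.cong) auto
  then show ?thesis by (simp add: sum.distrib sum_dev[OF assms])
qed

text \<open>
  The gain is truncated at \<open>n\<close> so that the exponential factor of the potential stays in the
  range where it is linearly bounded, even for very deep underloaded bins.
\<close>
lemma sum_min_gain:
  assumes n: "n \<ge> 2"
  obtains v where "(\<Sum>j<n. min (gain n x j) n) \<ge> n * (1 + v)" "v \<ge> under_frac n x"
    "v \<ge> min (overload n x / n) (1/2)"
proof
  \<comment> \<open>The excess of the mean truncated gain over the guaranteed single ball.\<close>
  define v where "v = (\<Sum>j<n. min (gain n x j) n - 1) / n"
  have nn: "min (gain n x j) n - 1 \<ge> 0" for j using gain_ge_1[of n x j] n by simp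
  show "(\<Sum>j<n. min (gain n x j) n) \<ge> n * (1 + v)"
    using n by (simp add: v_def sum_subtractf field_simps)
  have "min (gain n x j) n - 1 \<ge> (if dev n x j < 0 then 1 else 0)" for j
    using gain_underloaded(1)[of n x j] nn[of j] n by auto
  then show "v \<ge> under_frac n x"
    unfolding v_def under_frac_def by (intro divide_right_mono sum_mono) auto
  show "v \<ge> min (overload n x / n) (1/2)"
  \<comment> \<open>If truncation acts on some bin, that bin alone yields
    \<open>(n - 1) / n \<ge> 1/2\<close>. Otherwise each excess is at least the depth below the
    average, and the depths sum to the overload.\<close>
  proof (cases "\<exists>j<n. gain n x j > n")
    case True
    then obtain j where j: "j < n" "gain n x j > n" by blast
    have "(\<Sum>j<n. min (gain n x j) n - 1) \<ge> min (gain n x j) n - 1"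
      using j nn by (intro member_le_sum) auto
    also have "min (gain n x j) n - 1 = n - 1" using j by simp
    finally have "v \<ge> (real n - 1) / n" unfolding v_def using n by (intro divide_right_mono) auto
    moreover have "(real n - 1) / n \<ge> 1/2" using n by (simp add: field_simps)
    ultimately show ?thesis by linarith
  next
    case False
    then have "min (gain n x j) n - 1 \<ge> max 0 (- dev n x j)" if "j < n" for j
      using gain_underloaded(2)[of n x j] nn[of j] that by force
    then have "(\<Sum>j<n. min (gain n x j) n - 1) \<ge> overload n x"
      using n by (subst overload_eq_underload) (auto intro: sum_mono)
    then have "v \<ge> overload n x / n" unfolding v_def by (intro divide_right_mono) auto
    then show ?thesis by simp
  qed
qed

text \<open>From \<open>exp (- y) \<ge> 1 - y\<close>. With little overload, most bins are just
  above the average or below it, so one of the two sources of decrease is available.\<close>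

lemma over_weight_sum_ge:
  assumes n: "n > 0"
  shows "(\<Sum>i<n. over_weight n x i) / n + under_frac n x \<ge> 1 - overload n x / n"
proof -
  have "over_weight n x i + (if dev n x i < 0 then 1 else 0) \<ge> 1 - max 0 (dev n x i)" for i
    using exp_ge_add_one_self[of "- dev n x i"] by (auto simp: over_weight_def)
  then have "(\<Sum>i<n. over_weight n x i + (if dev n x i < 0 then 1 else 0)) \<ge> (\<Sum>i<n. 1 - max 0 (dev n x i))"
    by (intro sum_mono)
  then have "(\<Sum>i<n. over_weight n x i) + n * under_frac n x \<ge> n - overload n x"
    using n by (simp add: sum.distrib under_frac_def overload_def sum_subtractf)
  then have "(n - overload n x) / n \<le> ((\<Sum>i<n. over_weight n x i) + n * under_frac n x) / n"
    by (intro divide_right_mono) auto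
  then show ?thesis using n by (simp add: add_divide_distrib diff_divide_distrib)
qed

section \<open>The Lyapunov function\<close>

lemma exp_pot_ge_overload:
  assumes "a > 0"
  shows "exp_pot a n x \<ge> a * overload n x"
proof -
  have "exp (a * y) \<ge> a * max 0 y" for y
    using exp_ge_add_one_self[of "a * y"] by (cases "y \<ge> 0") (auto simp del: exp_ge_add_one_self)
  then show ?thesis by (simp add: exp_pot_def overload_def sum_distrib_left sum_mono)
qed

text \<open>Makes the decay factor linear in the gain, so that averaging over the hit bin only needs
  the sum of truncated gains.\<close>

lemma exp_minus_trunc_le:
  fixes z a :: real
  assumes "0 \<le> a" "a \<le> 1" "0 \<le> z"
  shows "exp (- (a * z)) \<le> 1 - (a - a^2) * min z 1"
proof -
  define t where "t = a * min z 1"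
  have t: "0 \<le> t" "t \<le> a" "t \<le> a * z"
    using assms by (auto simp: t_def mult_left_le intro: mult_left_mono)
  have "exp (- (a * z)) \<le> exp (- t)" using t by simp
  also have "exp (- t) \<le> 1 - t + t^2"
  proof -
    \<comment> \<open>The idea is \<open>(1 - t + t^2) * (1 + t) = 1 + t^3\<close> together with
      \<open>1 + t \<le> exp t\<close>.\<close>
    have "1 \<le> 1 + t * t^2" using t by simp
    also have "\<dots> = (1 - t + t^2) * (1 + t)" by (simp add: algebra_simps power2_eq_square)
    also have "\<dots> \<le> (1 - t + t^2) * exp t"
    proof (intro mult_left_mono)
      show "0 \<le> 1 - t + t^2" using t assms by (smt (verit) zero_le_power2)
    qed auto
    finally show ?thesis by (simp add: exp_minus field_simps)
  qed
  also have "t^2 \<le> a^2 * min z 1"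
  proof -
    have "min z 1 * min z 1 \<le> min z 1" using assms by (intro mult_left_le) auto
    then show ?thesis unfolding t_def power_mult_distrib by (intro mult_left_mono) (auto simp: power2_eq_square)
  qed
  finally show ?thesis by (simp add: t_def algebra_simps)
qed

text \<open>The decay factor is dropped on the term of the hit bin. An underloaded bin ends at most
  2 above the old average, whence \<open>exp (2 * a)\<close>.\<close>

lemma exp_pot_packing_step_le:
  assumes "j < n" "a \<ge> 0"
  shows "exp_pot a n (packing_step n x j) \<le> exp (- (a * gain n x j / n)) * exp_pot a n x +
    (if dev n x j \<ge> 0 then (exp a - 1) * exp (a * dev n x j) else exp (2 * a))"
proof -
  define E where "E = exp (- (a * gain n x j / n))"
  have g: "gain n x j \<ge> 1" by (rule gain_ge_1)
  have E: "0 \<le> E" "E \<le> 1" using assms g by (auto simp: E_def)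
  have ag: "exp (a * gain n x j) \<ge> 1" using assms g by simp
  have "exp_pot a n (packing_step n x j) = E * exp_pot a n x + E * (exp (a * dev n x j) * (exp (a * gain n x j) - 1))"
    by (simp add: exp_pot_packing_step[OF assms(1)] E_def algebra_simps)
  also have "E * (exp (a * dev n x j) * (exp (a * gain n x j) - 1)) \<le> 1 * (exp (a * dev n x j) * (exp (a * gain n x j) - 1))"
    using E ag by (intro mult_right_mono) auto
  also have "1 * (exp (a * dev n x j) * (exp (a * gain n x j) - 1)) \<le> (if dev n x j \<ge> 0 then (exp a - 1) * exp (a * dev n x j) else exp (2 * a))"
  proof (cases "dev n x j \<ge> 0")
    case True
    then show ?thesis by (simp add: gain_overloaded mult.commute)
  next
    case False
    then have "a * (dev n x j + gain n x j) \<le> a * 2"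
      using gain_underloaded(3)[of n x j] assms by (intro mult_left_mono) auto
    then have "exp (a * dev n x j) * exp (a * gain n x j) \<le> exp (2 * a)"
      by (simp add: algebra_simps flip: exp_add)
    moreover have "exp (a * dev n x j) \<ge> 0" by simp
    ultimately show ?thesis using False by (simp add: algebra_simps del: exp_ge_zero)
  qed
  finally show ?thesis by (simp add: E_def)
qed

text \<open>
  If few bins are underloaded, the average grows by hardly more than one ball per bin and the
  exponential potential alone need not decrease. But then the bins just above the average
  sink below it, which the bounded factor in \<open>lyap\<close> records.
\<close>

definition rate :: real where "rate = 1 / 400"

text \<open>Smaller when more bins lie low. The weight \<open>rate / 24\<close> keeps it away from 0
  and turns the loss \<open>3 * under_frac\<close> of the drift into
  \<open>rate / 8 * under_frac\<close>, which the faster growth of the average outweighs.\<close>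

definition damp :: "nat \<Rightarrow> (nat \<Rightarrow> nat) \<Rightarrow> real" where
  "damp n x = 1 - rate / 24 * (low_pot n x / n)"

definition lyap :: "nat \<Rightarrow> (nat \<Rightarrow> nat) \<Rightarrow> real" where
  "lyap n x = exp_pot rate n x * damp n x"

lemma damp_bounds: "damp n x \<le> 1" "n > 0 \<Longrightarrow> damp n x \<ge> 1 / 2"
proof -
  show "damp n x \<le> 1" using low_pot_bounds[of n x] by (simp add: damp_def rate_def)
  assume "n > 0"
  then show "damp n x \<ge> 1 / 2" using low_pot_bounds[of n x] by (simp add: damp_def rate_def field_simps)
qed

lemma exp_pot_nonneg: "exp_pot a n x \<ge> 0"
  unfolding exp_pot_def by (intro sum_nonneg) auto

text \<open>Multiplies the bounds for both factors of \<open>lyap\<close>; the cross terms cost at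
  most \<open>P / n^2\<close> and \<open>B / n\<close>.\<close>

lemma lyap_packing_step_le:
  fixes n x j
  defines "P \<equiv> exp_pot rate n x" and "K \<equiv> damp n x"
    and "B \<equiv> (if dev n x j \<ge> 0 then (exp rate - 1) * exp (rate * dev n x j) else exp (2 * rate))"
  assumes j: "j < n"
  shows "lyap n (packing_step n x j) \<le>
     P * (K * (1 - (rate - rate^2) * min (gain n x j) n / n) - rate / 24 * low_drift n x j / n + 1 / n^2)
     + B * (K + 1 / n)"
proof -
  define E where "E = exp (- (rate * (gain n x j / n)))"
  define d where "d = low_drift n x j"
  have n: "n > 0" using j by simp
  have g: "gain n x j \<ge> 1" by (rule gain_ge_1)
  have P: "P \<ge> 0" by (simp add: P_def exp_pot_nonneg)
  have B: "B \<ge> 0" by (simp add: B_def rate_def)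
  have d: "\<bar>d\<bar> \<le> 4" using low_drift_bounds(1)[OF j] by (simp add: d_def)
  have E: "0 \<le> E" "E \<le> 1" using g by (auto simp: E_def rate_def)
  have K: "K \<ge> 0" using damp_bounds(2)[OF n, of x] by (simp add: K_def)
  have pot: "exp_pot rate n (packing_step n x j) \<le> E * P + B"
    using exp_pot_packing_step_le[OF j, of rate x] by (simp add: E_def P_def B_def rate_def)
  have "low_pot n (packing_step n x j) / n \<ge> (low_pot n x + d) / n"
    using low_pot_packing_step[OF j, of x] by (intro divide_right_mono) (auto simp: d_def)
  then have damp: "damp n (packing_step n x j) \<le> K - rate / 24 * d / n"
    unfolding damp_def K_def rate_def by (simp add: add_divide_distrib)
  have "lyap n (packing_step n x j) \<le> (E * P + B) * damp n (packing_step n x j)"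
    unfolding lyap_def using damp_bounds(2)[OF n, of "packing_step n x j"]
    by (intro mult_right_mono pot) auto
  also have "\<dots> \<le> (E * P + B) * (K - rate / 24 * d / n)"
    using E P B by (intro mult_left_mono damp) auto
  also have "\<dots> = P * (K * E + rate / 24 * (- E * d) / n) + B * (K + rate / 24 * (- d) / n)"
    by (simp add: algebra_simps add_divide_distrib)
  also have "\<dots> \<le> P * (K * (1 - (rate - rate^2) * min (gain n x j) n / n) - rate / 24 * d / n + 1 / n^2) + B * (K + 1 / n)"
  proof (rule add_mono[OF mult_left_mono[OF _ P] mult_left_mono[OF _ B]])
    \<comment> \<open>Here \<open>9600 = 24 / rate\<close>.\<close>
    have "- d / 9600 \<le> 1" using d by auto
    then have "- d / 9600 / n \<le> 1 / n" by (intro divide_right_mono) auto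
    then show "K + rate / 24 * (- d) / n \<le> K + 1 / n" by (simp add: rate_def)
    have "E \<le> 1 - (rate - rate^2) * min (gain n x j / n) 1"
      unfolding E_def using g by (intro exp_minus_trunc_le) (auto simp: rate_def)
    also have "min (gain n x j / n) 1 = min (gain n x j) n / n"
      using n by (auto simp: min_def field_simps)
    finally have 1: "K * E \<le> K * (1 - (rate - rate^2) * min (gain n x j) n / n)"
      by (intro mult_left_mono K) auto
    \<comment> \<open>An underloaded bin may make \<open>E\<close> small, but then
      \<open>d \<le> 0\<close>; an overloaded bin gains exactly 1, so \<open>E\<close> is within
      \<open>1 / n\<close> of 1.\<close>
    have 2: "- E * d \<le> - d + 4 / n"
    proof (cases "dev n x j < 0")
      case True
      then have "d \<le> 0" using low_drift_bounds(2)[OF j] by (simp add: d_def)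
      then have "E * (- d) \<le> 1 * (- d)" using E by (intro mult_right_mono) auto
      moreover have "4 / real n \<ge> 0" by simp
      ultimately show ?thesis by linarith
    next
      case False
      then have "E = exp (- (rate / n))" using gain_overloaded[of n x j] by (simp add: E_def)
      then have "E \<ge> 1 - rate / n" using exp_ge_add_one_self[of "- (rate / n)"] by simp
      moreover have "rate / n \<le> 1 / n" by (intro divide_right_mono) (auto simp: rate_def)
      ultimately have *: "1 - E \<le> 1 / n" by linarith
      have "(1 - E) * d \<le> (1 - E) * 4" using E d by (intro mult_left_mono) auto
      also have "\<dots> \<le> 1 / n * 4" using * by (intro mult_right_mono) auto
      finally show ?thesis by (simp add: algebra_simps)
    qed
    have "rate / 24 * (- E * d) / n \<le> rate / 24 * (- d + 4 / n) / n"
      using 2 by (intro divide_right_mono mult_left_mono) (auto simp: rate_def)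
    also have "\<dots> \<le> - (rate / 24 * d / n) + 1 / n^2"
      using n by (simp add: rate_def field_simps power2_eq_square)
    finally show "K * E + rate / 24 * (- E * d) / n \<le>
      K * (1 - (rate - rate^2) * min (gain n x j) n / n) - rate / 24 * d / n + 1 / n^2"
      using 1 by linarith
  qed
  finally show ?thesis by (simp add: d_def)
qed

text \<open>Linearity, for summing the bound of \<open>lyap_packing_step_le\<close> over the hit
  bin.\<close>

lemma sum_affine:
  fixes f g h :: "nat \<Rightarrow> real"
  shows "(\<Sum>j<m. P * (K * (1 - c * f j / N) - b * g j / N + q) + h j * k) =
    P * (K * (m - c * sum f {..<m} / N) - b * sum g {..<m} / N + m * q) + sum h {..<m} * k"
  by (induction m) (auto simp: algebra_simps add_divide_distrib)

text \<open>To first order in \<open>rate\<close>, growth through hits cancels against the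
  guaranteed rise of the average by one ball. What remains is an error \<open>2 * rate^2\<close>
  against the extra rise \<open>v\<close> and the damping gain \<open>s\<close>.\<close>

lemma lyap_drift:
  assumes n: "n \<ge> 1000000"
  shows "(\<Sum>j<n. lyap n (packing_step n x j)) / n \<le> lyap n x * (1 - rate / 1000 / n) + 3"
proof -
  define P where "P = exp_pot rate n x"
  define K where "K = damp n x"
  define u where "u = under_frac n x"
  define s where "s = (\<Sum>i<n. over_weight n x i) / n"
  define d where "d = overload n x / n"
  define B where "B = (\<lambda>j. if dev n x j \<ge> 0 then (exp rate - 1) * exp (rate * dev n x j) else exp (2 * rate))"
  have n2: "n \<ge> 2" using n by simp
  obtain v :: real where v: "(\<Sum>j<n. min (gain n x j) n) \<ge> n * (1 + v)" "v \<ge> u" "v \<ge> min d (1/2)"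
    unfolding u_def d_def by (rule sum_min_gain[OF n2])
  define M where "M = (\<Sum>j<n. min (gain n x j) n)"
  define Dr where "Dr = (\<Sum>j<n. low_drift n x j)"
  define SB where "SB = (\<Sum>j<n. B j)"
  have P: "P \<ge> 0" by (simp add: P_def exp_pot_nonneg)
  have n0: "n > 0" using n by simp
  have K: "K \<ge> 1/2" "K \<le> 1" using damp_bounds n0 by (auto simp: K_def)
  have u0: "u \<ge> 0" unfolding u_def under_frac_def by (intro divide_nonneg_nonneg sum_nonneg) auto
  have s0: "s \<ge> 0" unfolding s_def by (intro divide_nonneg_nonneg sum_nonneg over_weight_bounds) auto
  have ge: "s + u \<ge> 1 - d" using over_weight_sum_ge[OF n0, of x] by (simp add: s_def u_def d_def)
  \<comment> \<open>If \<open>d \<ge> 1/4\<close>, then \<open>v \<ge> 1/4\<close> suffices.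
    Otherwise \<open>s + v \<ge> s + u \<ge> 3/4\<close>, and
    \<open>(3/4) / 72 = 1/96\<close>.\<close>
  have drift: "v / 8 + s / 72 \<ge> 1 / 100"
    using ge v(2,3) u0 s0 by (cases "d \<ge> 1/4") (auto simp: min_def split: if_splits)
  have e1: "exp rate - 1 \<le> rate + rate^2"
    using exp_bound[of rate] by (simp add: rate_def)
  have e2: "exp (2 * rate) \<le> 2"
    using exp_bound[of "2 * rate"] by (simp add: rate_def power2_eq_square)
  have sumB: "(\<Sum>j<n. B j) \<le> (rate + rate^2) * P + 2 * real n"
  proof -
    have "B j \<le> (rate + rate^2) * exp (rate * dev n x j) + 2" for j
    proof -
      have "(exp rate - 1) * exp (rate * dev n x j) \<le> (rate + rate^2) * exp (rate * dev n x j)"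
        using e1 by (intro mult_right_mono) auto
      moreover have "(rate + rate^2) * exp (rate * dev n x j) \<ge> 0" by (simp add: rate_def)
      ultimately show ?thesis using e2 unfolding B_def by (smt (verit))
    qed
    then have "(\<Sum>j<n. B j) \<le> (\<Sum>j<n. (rate + rate^2) * exp (rate * dev n x j) + 2)"
      by (intro sum_mono)
    then show ?thesis by (simp add: sum.distrib P_def exp_pot_def sum_distrib_left)
  qed
  have "(\<Sum>j<n. lyap n (packing_step n x j)) \<le>
    (\<Sum>j<n. P * (K * (1 - (rate - rate^2) * min (gain n x j) n / n) - rate / 24 * low_drift n x j / n + 1 / n^2)
     + B j * (K + 1 / n))"
    by (intro sum_mono) (use lyap_packing_step_le[of _ n x] in \<open>auto simp: P_def K_def B_def\<close>)
  also have "\<dots> = P * (K * (n - (rate - rate^2) * M / n) - rate / 24 * Dr / n + n * (1 / n^2)) + SB * (K + 1 / n)"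
    unfolding M_def Dr_def SB_def by (rule sum_affine)
  also have "\<dots> \<le> P * (K * (n - (rate - rate^2) * (1 + v)) - rate / 24 * (s / 3 - 1 / n - 3 * u) + 1 / n)
      + ((rate + rate^2) * P + 2 * real n) * (K + 1 / n)"
  proof (intro add_mono mult_left_mono mult_right_mono diff_mono P)
    show "SB \<le> (rate + rate^2) * P + 2 * real n" using sumB by (simp add: SB_def)
    have "(rate - rate^2) * (1 + v) \<le> (rate - rate^2) * (M / n)"
      using v(1) n0 by (intro mult_left_mono) (auto simp: rate_def power2_eq_square M_def field_simps)
    then show "(rate - rate^2) * (1 + v) \<le> (rate - rate^2) * M / n" by simp
    have "Dr \<ge> n * s / 3 - 1 - 3 * n * u"
      using sum_low_drift[OF n0, of x] n0 by (simp add: s_def u_def Dr_def)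
    then have "(n * s / 3 - 1 - 3 * n * u) / n \<le> Dr / n" by (intro divide_right_mono) auto
    also have "(n * s / 3 - 1 - 3 * n * u) / n = s / 3 - 1 / n - 3 * u"
      using n0 by (simp add: diff_divide_distrib)
    finally show "rate / 24 * (s / 3 - 1 / n - 3 * u) \<le> rate / 24 * Dr / n"
      by (simp add: rate_def)
    show "real n * (1 / n^2) \<le> 1 / n" using n0 by (simp add: power2_eq_square)
  qed (use K in auto)
  also have "\<dots> = P * (K * (n - (rate - rate^2) * (1 + v) + (rate + rate^2)) - rate / 72 * s + rate / 8 * u
       + (rate / 24 + 1 + (rate + rate^2)) * (1 / n)) + 2 * real n * K + 2"
  proof -
    define w where "w = 1 / real n"
    have nw: "real n * w = 1" using n0 by (simp add: w_def)
    have "P * (K * (n - (rate - rate^2) * (1 + v)) - rate / 24 * (s / 3 - w - 3 * u) + w)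
        + ((rate + rate^2) * P + 2 * real n) * (K + w) =
      P * (K * (n - (rate - rate^2) * (1 + v) + (rate + rate^2)) - rate / 72 * s + rate / 8 * u
       + (rate / 24 + 1 + (rate + rate^2)) * w) + 2 * real n * K + 2 * (real n * w)"
      by (simp add: field_simps)
    then show ?thesis unfolding nw unfolding w_def by simp
  qed
  also have "\<dots> \<le> P * (n * K - rate / 1000) + 3 * n"
  proof -
    \<comment> \<open>The bracket equals \<open>2 * rate^2 - (rate - rate^2) * v\<close>;
      \<open>K \<le> 1\<close> serves the first term, \<open>K \<ge> 1/2\<close> the second.\<close>
    have a: "K * (- (rate - rate^2) * (1 + v) + (rate + rate^2)) \<le> 2 * rate^2 - rate / 4 * v"
    proof -
      have v0: "v \<ge> 0" using v(2) u0 by simp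
      have "(rate - rate^2) * v \<ge> rate / 2 * v" using v0 by (intro mult_right_mono) (auto simp: rate_def power2_eq_square)
      then have "K * (- (rate - rate^2) * (1 + v) + (rate + rate^2)) \<le> K * (2 * rate^2 - rate / 2 * v)"
        using K by (intro mult_left_mono) (auto simp: algebra_simps)
      also have "\<dots> = K * (2 * rate^2) - K * (rate / 2 * v)" by (simp add: algebra_simps)
      also have "K * (2 * rate^2) \<le> 1 * (2 * rate^2)" using K by (intro mult_right_mono) auto
      finally have "K * (- (rate - rate^2) * (1 + v) + (rate + rate^2)) \<le> 2 * rate^2 - K * (rate / 2 * v)" by simp
      moreover have "K * (rate / 2 * v) \<ge> 1/2 * (rate / 2 * v)" using K v0 by (intro mult_right_mono) (auto simp: rate_def)
      ultimately show ?thesis by simp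
    qed
    have b: "(rate / 24 + 1 + (rate + rate^2)) * (1 / n) \<le> 2 / 1000000"
    proof -
      have "(rate / 24 + 1 + (rate + rate^2)) * (1 / n) \<le> 2 * (1 / n)"
        by (intro mult_right_mono) (auto simp: rate_def power2_eq_square)
      also have "\<dots> = 2 / n" by simp
      also have "\<dots> \<le> 2 / 1000000" using n by (intro divide_left_mono) auto
      finally show ?thesis .
    qed
    have "K * (n - (rate - rate^2) * (1 + v) + (rate + rate^2)) - rate / 72 * s + rate / 8 * u
       + (rate / 24 + 1 + (rate + rate^2)) * (1 / n) \<le> n * K + 2 * rate^2 - rate / 4 * v - rate / 72 * s + rate / 8 * u + 2 / 1000000"
      using a b by (simp add: algebra_simps)
    \<comment> \<open>As \<open>u \<le> v\<close>, half of \<open>rate / 4 * v\<close> absorbs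
      \<open>rate / 8 * u\<close>.\<close>
    also have "\<dots> \<le> n * K + 2 * rate^2 - rate * (v / 8 + s / 72) + 2 / 1000000"
      using v(2) by (simp add: rate_def algebra_simps)
    \<comment> \<open>The choice of \<open>rate\<close> enters:
      \<open>2 * rate^2 = rate / 200\<close> is half of the drift \<open>rate / 100\<close>.\<close>
    also have "\<dots> \<le> n * K - rate / 1000"
      using drift by (simp add: rate_def power2_eq_square field_simps)
    finally have "P * (K * (n - (rate - rate^2) * (1 + v) + (rate + rate^2)) - rate / 72 * s + rate / 8 * u
       + (rate / 24 + 1 + (rate + rate^2)) * (1 / n)) \<le> P * (n * K - rate / 1000)"
      using P by (intro mult_left_mono)
    moreover have "2 * real n * K \<le> 2 * real n * 1" using K by (intro mult_left_mono) auto
    moreover have "2 \<le> real n" using n by simp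
    ultimately show ?thesis by linarith
  qed
  finally have "(\<Sum>j<n. lyap n (packing_step n x j)) / n \<le> (P * (n * K - rate / 1000) + 3 * n) / n"
    by (intro divide_right_mono) auto
  also have "\<dots> = P * K - P * (rate / 1000 / n) + 3" using n0 by (simp add: field_simps)
  finally have "(\<Sum>j<n. lyap n (packing_step n x j)) / n \<le> P * K - P * (rate / 1000 / n) + 3" .
  moreover have "P * (rate / 1000 / n) \<ge> P * K * (rate / 1000 / n)"
    using P K by (intro mult_right_mono) (auto simp: rate_def mult_left_le)
  ultimately show ?thesis by (simp add: lyap_def P_def K_def algebra_simps)
qed

section \<open>Expected growth of the average\<close>

lemma expectation_bind_uniform:
  fixes f :: "'b \<Rightarrow> real"
  assumes "finite (set_pmf p)" "n > 0"
  shows "measure_pmf.expectation (p \<bind> (\<lambda>x. map_pmf (g x) (pmf_of_set {..<n::nat}))) f =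
    measure_pmf.expectation p (\<lambda>x. (\<Sum>j<n. f (g x j)) / n)"
proof -
  have ne: "{..<n} \<noteq> {}" using assms by auto
  show ?thesis
    by (subst pmf_expectation_bind[OF assms(1)])
      (use ne assms in \<open>auto simp: integral_pmf_of_set integral_measure_pmf[of "set_pmf p"] set_pmf_of_set simp flip: sum_divide_distrib\<close>)
qed

lemma finite_set_packing: "n > 0 \<Longrightarrow> finite (set_pmf (packing n t))"
  by (induction t) (auto simp: set_pmf_of_set lessThan_empty_iff)

lemma expectation_packing_Suc:
  assumes "n > 0"
  shows "measure_pmf.expectation (packing n (Suc t)) f =
    measure_pmf.expectation (packing n t) (\<lambda>x. (\<Sum>j<n. f (packing_step n x j)) / n :: real)"
  unfolding packing.simps by (rule expectation_bind_uniform) (use assms finite_set_packing in auto)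

lemma integrable_packing:
  fixes f :: "_ \<Rightarrow> real"
  shows "n > 0 \<Longrightarrow> integrable (measure_pmf (packing n t)) f"
  by (intro integrable_measure_pmf_finite finite_set_packing)

lemma lyap_0: "n > 0 \<Longrightarrow> lyap n (\<lambda>_. 0) \<le> n"
proof -
  assume "n > 0"
  have "exp_pot rate n (\<lambda>_. 0) = n" by (simp add: exp_pot_def dev_def avg_load_def total_load_def)
  then show ?thesis using damp_bounds(1)[of n] by (simp add: lyap_def mult_left_le)
qed

text \<open>Since \<open>1200000 = 3 * 1000 / rate\<close>, the bound is the fixed point of the
  recursion from \<open>lyap_drift\<close>, hence uniform in \<open>t\<close>.\<close>

lemma expectation_lyap:
  assumes n: "n \<ge> 1000000"
  shows "measure_pmf.expectation (packing n t) (lyap n) \<le> 1200000 * n"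
proof (induction t)
  case 0
  have "real n \<le> 1200000 * real n" by simp
  then show ?case using lyap_0[of n] n by auto
next
  case (Suc t)
  have n0: "n > 0" using n by simp
  define q where "q = 1 - rate / 1000 / n"
  have q: "q \<ge> 0" using n by (simp add: q_def rate_def)
  have "measure_pmf.expectation (packing n (Suc t)) (lyap n) \<le>
    measure_pmf.expectation (packing n t) (\<lambda>x. lyap n x * q + 3)"
    unfolding expectation_packing_Suc[OF n0] q_def
    by (intro integral_mono integrable_packing n0 lyap_drift n)
  also have "\<dots> = measure_pmf.expectation (packing n t) (lyap n) * q + 3"
    using n0 by (simp add: integrable_packing)
  also have "\<dots> \<le> 1200000 * n * q + 3"
    by (intro add_mono mult_right_mono Suc.IH q) auto
  also have "\<dots> = 1200000 * n" using n0 by (simp add: q_def rate_def field_simps)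
  finally show ?case .
qed

lemma expectation_overload:
  assumes n: "n \<ge> 1000000"
  shows "measure_pmf.expectation (packing n t) (overload n) \<le> 960000000 * n"
proof -
  have n0: "n > 0" using n by simp
  \<comment> \<open>Here \<open>800 = 2 / rate\<close>: the 2 comes from
    \<open>damp \<ge> 1/2\<close>, the rest from \<open>exp_pot_ge_overload\<close>.\<close>
  have "overload n x \<le> 800 * lyap n x" for x
  proof -
    have "exp_pot rate n x * (1 / 2) \<le> lyap n x"
      unfolding lyap_def by (intro mult_left_mono damp_bounds n0 exp_pot_nonneg)
    then show ?thesis using exp_pot_ge_overload[of rate n x] by (simp add: rate_def)
  qed
  then have "measure_pmf.expectation (packing n t) (overload n) \<le> measure_pmf.expectation (packing n t) (\<lambda>x. 800 * lyap n x)"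
    by (intro integral_mono integrable_packing n0)
  also have "\<dots> \<le> 800 * (1200000 * n)" using expectation_lyap[OF n, of t] by simp
  finally show ?thesis by simp
qed

text \<open>The summand 2 accounts for filling up to strictly less than 2 above the average.\<close>
definition growth :: real where "growth = 960000002"

text \<open>Up to 2 per bin, the gains over all bins sum to the total depth below the average. This
  equals the overload, which is \<open>O(n)\<close> in expectation at any time.\<close>

lemma expectation_avg_load_add:
  assumes n: "n \<ge> 1000000"
  shows "measure_pmf.expectation (packing n (s + t)) (avg_load n) \<le>
    measure_pmf.expectation (packing n s) (avg_load n) + growth * t / n"
proof (induction t)
  case (Suc t)
  have n0: "n > 0" using n by simp
  have *: "(\<Sum>j<n. avg_load n (packing_step n x j)) / n \<le> avg_load n x + (2 / n + overload n x / n^2)" for x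
  proof -
    have "gain n x j \<le> 2 + max 0 (- dev n x j)" for j
      using gain_overloaded[of n x j] gain_underloaded(3)[of n x j] by (cases "dev n x j \<ge> 0") auto
    then have "(\<Sum>j<n. gain n x j) \<le> (\<Sum>j<n. 2 + max 0 (- dev n x j))" by (intro sum_mono)
    also have "\<dots> = 2 * n + overload n x" by (simp add: sum.distrib overload_eq_underload[OF n0])
    finally have "(\<Sum>j<n. gain n x j) / n^2 \<le> (2 * n + overload n x) / n^2" by (intro divide_right_mono) auto
    moreover have "(\<Sum>j<n. avg_load n (packing_step n x j)) / n = avg_load n x + (\<Sum>j<n. gain n x j) / n^2"
      using n0 by (simp add: avg_load_packing_step sum.distrib sum_divide_distrib[symmetric] add_divide_distrib power2_eq_square)
    ultimately show ?thesis using n0 by (simp add: add_divide_distrib power2_eq_square)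
  qed
  have "measure_pmf.expectation (packing n (s + Suc t)) (avg_load n) \<le>
    measure_pmf.expectation (packing n (s + t)) (\<lambda>x. avg_load n x + (2 / n + overload n x / n^2))"
    unfolding add_Suc_right expectation_packing_Suc[OF n0]
    by (intro integral_mono integrable_packing n0 *)
  also have "\<dots> = measure_pmf.expectation (packing n (s + t)) (avg_load n) + (2 / n +
      measure_pmf.expectation (packing n (s + t)) (overload n) / n^2)"
    using n0 by (simp add: integrable_packing)
  also have "measure_pmf.expectation (packing n (s + t)) (overload n) / n^2 \<le> 960000000 * n / n^2"
    by (intro divide_right_mono expectation_overload n) auto
  also have "960000000 * n / n^2 = 960000000 / n" using n0 by (simp add: power2_eq_square)
  finally have "measure_pmf.expectation (packing n (s + Suc t)) (avg_load n) \<le>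
    measure_pmf.expectation (packing n (s + t)) (avg_load n) + growth / n"
    by (simp add: growth_def)
  also have "\<dots> \<le> measure_pmf.expectation (packing n s) (avg_load n) + growth * Suc t / n"
    using Suc.IH by (simp add: add_divide_distrib ring_distribs)
  finally show ?case .
qed simp

section \<open>Replaying a window of rounds on a list of drawn bins\<close>

definition run :: "nat \<Rightarrow> (nat \<Rightarrow> nat) \<Rightarrow> nat list \<Rightarrow> nat \<Rightarrow> nat" where
  "run n = foldl (packing_step n)"

text \<open>Makes the draws of the window independent of the loads at its start. The induction peels
  off the first round, as \<open>foldl\<close> and \<open>replicate_pmf\<close> do, so
  \<open>s\<close> must be arbitrary.\<close>

lemma packing_add:
  "packing n (s + t) = map_pmf (\<lambda>(x, js). run n x js)
     (pair_pmf (packing n s) (replicate_pmf t (pmf_of_set {..<n})))"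
proof (induction t arbitrary: s)
  case 0
  show ?case by (simp add: pair_pmf_def run_def map_bind_pmf bind_return_pmf bind_return_pmf')
next
  case (Suc t)
  have "packing n (s + Suc t) = packing n (Suc s + t)" by simp
  also note Suc.IH
  finally show ?case
    by (simp add: pair_pmf_def run_def map_pmf_def bind_assoc_pmf bind_return_pmf)
qed

lemma avg_load_run:
  "set js \<subseteq> {..<n} \<Longrightarrow> avg_load n x \<le> avg_load n (run n x js)"
proof (induction js rule: rev_induct)
  case (snoc j js)
  have "gain n (run n x js) j / n \<ge> 0" using gain_ge_1[of n "run n x js" j] by simp
  moreover have "run n x (js @ [j]) = packing_step n (run n x js) j" by (simp add: run_def)
  ultimately show ?case using snoc by (simp add: avg_load_packing_step)
qed (simp add: run_def)

text \<open>
  Whatever the load of a bin was before, its first hit lifts it above the average at the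
  beginning of the run.
\<close>
lemma run_ge_count:
  assumes "set js \<subseteq> {..<n}" "count_list js i > 0"
  shows "real (run n x js i) \<ge> avg_load n x + count_list js i"
  using assms
proof (induction js rule: rev_induct)
  case (snoc j js)
  define x' where "x' = run n x js"
  have run: "run n x (js @ [j]) = packing_step n x' j" by (simp add: run_def x'_def)
  show ?case
  proof (cases "i = j")
    case False
    then show ?thesis using snoc unfolding run by (simp add: packing_step_def x'_def)
  next
    case True
    have avg: "avg_load n x \<le> avg_load n x'" unfolding x'_def using snoc by (intro avg_load_run) auto
    have "real (packing_step n x' i i) \<ge> avg_load n x' + 1"
      using gain_overloaded[of n x' i] gain_underloaded(2)[of n x' i]
      by (cases "dev n x' i \<ge> 0") (auto simp: packing_step_eq dev_def)
    moreover have "real (packing_step n x' i i) \<ge> real (x' i) + 1"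
      using gain_ge_1[of n x' i] by (simp add: packing_step_eq)
    \<comment> \<open>A first hit is measured from the average; a later one adds to the induction
      hypothesis.\<close>
    ultimately show ?thesis
      using snoc True avg unfolding run by (cases "count_list js i = 0") (auto simp: x'_def)
  qed
qed simp

text \<open>Separates the hits of a bin from the rise of the average, so that a union bound can
  combine them.\<close>

lemma gap_run_ge:
  assumes "set js \<subseteq> {..<n}" "i < n" "count_list js i > 0"
  shows "gap n (run n x js) \<ge> count_list js i - (avg_load n (run n x js) - avg_load n x)"
proof -
  have "run n x js i \<le> Max (run n x js ` {..<n})" using assms by (intro Max_ge) auto
  then show ?thesis using run_ge_count[OF assms(1,3), of x] unfolding gap_def by linarith
qed

section \<open>Bins with many hits\<close>

text \<open>Exponential moments of the hit counts obey closed recursions when a draw is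
  added.\<close>

definition hit_sum :: "nat \<Rightarrow> real \<Rightarrow> nat list \<Rightarrow> real" where
  "hit_sum n z js = (\<Sum>i<n. z ^ count_list js i)"

lemma hit_sum_nonneg: "z \<ge> 0 \<Longrightarrow> hit_sum n z js \<ge> 0"
  unfolding hit_sum_def by (intro sum_nonneg) auto

abbreviation hits :: "nat \<Rightarrow> nat \<Rightarrow> nat list pmf" where
  "hits n t \<equiv> replicate_pmf t (pmf_of_set {..<n})"

lemma finite_set_hits: "n > 0 \<Longrightarrow> finite (set_pmf (hits n t))"
  by (induction t) (auto simp: set_pmf_of_set lessThan_empty_iff)

lemma integrable_hits:
  fixes f :: "_ \<Rightarrow> real"
  shows "n > 0 \<Longrightarrow> integrable (measure_pmf (hits n t)) f"
  by (intro integrable_measure_pmf_finite finite_set_hits)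

lemma expectation_hits_Suc:
  assumes "n > 0"
  shows "measure_pmf.expectation (hits n (Suc t)) f =
    measure_pmf.expectation (hits n t) (\<lambda>js. (\<Sum>j<n. f (j # js)) / n :: real)"
proof -
  \<comment> \<open>\<open>replicate_pmf\<close> draws the head first; exchanging independent draws
    puts the new one last.\<close>
  have "hits n (Suc t) = hits n t \<bind> (\<lambda>js. map_pmf (\<lambda>j. j # js) (pmf_of_set {..<n}))"
    by (simp add: map_pmf_def bind_commute_pmf[of "hits n t"])
  then show ?thesis
    by (simp only:) (rule expectation_bind_uniform, use assms finite_set_hits in auto)
qed

lemma hit_sum_Cons: "j < n \<Longrightarrow> hit_sum n z (j # js) = hit_sum n z js + (z - 1) * z ^ count_list js j"
proof -
  assume j: "j < n"
  have "hit_sum n z (j # js) = (\<Sum>i<n. z ^ count_list js i + (if i = j then (z - 1) * z ^ count_list js j else 0))"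
    unfolding hit_sum_def by (intro sum.cong) (auto simp: algebra_simps)
  then show ?thesis using j by (simp add: sum.distrib hit_sum_def)
qed

text \<open>A draw adds \<open>(z - 1) * z ^ count\<close> for a uniform bin, on average the
  fraction \<open>(z - 1) / n\<close> of the current sum.\<close>

lemma expectation_hit_sum:
  assumes "n > 0"
  shows "measure_pmf.expectation (hits n t) (hit_sum n z) = n * (1 + (z - 1) / n) ^ t"
proof (induction t)
  case 0
  show ?case by (simp add: hit_sum_def)
next
  case (Suc t)
  have "(\<Sum>j<n. hit_sum n z (j # js)) / n = (1 + (z - 1) / n) * hit_sum n z js" for js
  proof -
    have "(\<Sum>j<n. hit_sum n z (j # js)) = n * hit_sum n z js + (z - 1) * hit_sum n z js"
      by (simp add: hit_sum_Cons sum.distrib sum_distrib_left[symmetric]) (simp add: hit_sum_def)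
    then show ?thesis using assms by (simp add: field_simps)
  qed
  then show ?case using assms Suc by (simp add: expectation_hits_Suc del: replicate_pmf.simps)
qed

text \<open>The recursion for the second moment involves the first moment for base
  \<open>z^2\<close>, which grows by the factor \<open>1 + (z^2 - 1) / n\<close> per draw. Each draw
  then adds at most one of the \<open>t\<close> equal error terms.\<close>

lemma expectation_hit_sum_sq:
  assumes n: "n > 0" and z: "z \<ge> 1"
  shows "measure_pmf.expectation (hits n t) (\<lambda>js. (hit_sum n z js)^2) \<le>
    (n * (1 + (z - 1) / n) ^ t)^2 + t * (z - 1)^2 * (1 + (z^2 - 1) / n) ^ t"
proof (induction t)
  case 0
  show ?case by (simp add: hit_sum_def)
next
  case (Suc t)
  define a where "a = 1 + (z - 1) / n"
  define b where "b = 1 + (z^2 - 1) / n"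
  have z2: "z^2 \<ge> 1" using z by (simp add: one_le_power)
  have b: "b \<ge> 1" using z2 by (simp add: b_def)
  have n1: "real n \<ge> 1" using n by simp
  \<comment> \<open>\<open>a\<close> and \<open>b\<close> are the first two moments of a variable
    equal to \<open>z\<close> with probability \<open>1 / n\<close> and to 1 otherwise, so
    \<open>b - a^2\<close> is a variance.\<close>
  have ab: "a^2 \<le> b"
  proof -
    have "((z - 1) / n)^2 \<le> (z - 1)^2 / n"
      unfolding power_divide using n1 by (intro divide_left_mono) (auto simp: self_le_power)
    moreover have "b - a^2 = (z - 1)^2 / n - ((z - 1) / n)^2"
      using n by (simp add: a_def b_def power2_eq_square field_simps)
    ultimately show ?thesis by simp
  qed
  have *: "(\<Sum>j<n. (hit_sum n z (j # js))^2) / n = (1 + 2 * (z - 1) / n) * (hit_sum n z js)^2 + (z - 1)^2 / n * hit_sum n (z^2) js" for js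
  proof -
    have "(\<Sum>j<n. (hit_sum n z (j # js))^2) =
      (\<Sum>j<n. (hit_sum n z js)^2 + 2 * (z - 1) * hit_sum n z js * z ^ count_list js j + (z - 1)^2 * (z^2) ^ count_list js j)"
      by (intro sum.cong) (auto simp: hit_sum_Cons power2_eq_square power_mult_distrib algebra_simps)
    also have "\<dots> = n * (hit_sum n z js)^2 + 2 * (z - 1) * hit_sum n z js * hit_sum n z js + (z - 1)^2 * hit_sum n (z^2) js"
      by (simp add: sum.distrib sum_distrib_left hit_sum_def)
    finally show ?thesis using n by (simp add: add_divide_distrib distrib_right power2_eq_square mult.assoc)
  qed
  have "measure_pmf.expectation (hits n (Suc t)) (\<lambda>js. (hit_sum n z js)^2) =
    (1 + 2 * (z - 1) / n) * measure_pmf.expectation (hits n t) (\<lambda>js. (hit_sum n z js)^2) + (z - 1)^2 / n * (n * b ^ t)"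
    unfolding expectation_hits_Suc[OF n] * using n
    by (simp add: integrable_hits expectation_hit_sum b_def)
  also have "\<dots> \<le> a^2 * ((n * a ^ t)^2 + t * (z - 1)^2 * b ^ t) + (z - 1)^2 / n * (n * b ^ t)"
  proof (rule add_right_mono, rule mult_mono)
    have "a^2 = 1 + 2 * (z - 1) / n + ((z - 1) / n)^2"
      using n by (simp add: a_def power2_eq_square field_simps)
    then show "1 + 2 * (z - 1) / n \<le> a^2" using zero_le_power2[of "(z - 1) / n"] by linarith
  qed (use Suc.IH in \<open>auto simp: a_def b_def intro!: integral_nonneg\<close>)
  also have "\<dots> = (n * a ^ Suc t)^2 + a^2 * (t * (z - 1)^2 * b ^ t) + (z - 1)^2 * b ^ t"
  proof -
    have "(z - 1)^2 / n * (n * b ^ t) = (z - 1)^2 * b ^ t" using n by simp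
    then show ?thesis by (simp only:) (simp add: power_mult_distrib algebra_simps power2_eq_square)
  qed
  also have "a^2 * (t * (z - 1)^2 * b ^ t) \<le> b * (t * (z - 1)^2 * b ^ t)"
    using ab b by (intro mult_right_mono) auto
  also have "(z - 1)^2 * b ^ t \<le> (z - 1)^2 * (b * b ^ t)"
    using b by (intro mult_left_mono) auto
  finally show ?case
    unfolding a_def[symmetric] b_def[symmetric] by (simp add: algebra_simps del: replicate_pmf.simps)
qed

text \<open>
  The weight \<open>z ^ hits\<close> tilts the sampling towards bins with many hits: the tilted sum
  concentrates, and it would exceed its typical size for the smaller base \<open>z / 2\<close> if all bins
  had few hits.
\<close>
lemma prob_few_hits:
  assumes n: "n > 0" and z: "z \<ge> 2"
  shows "measure_pmf.prob (hits n t) {js. \<forall>i<n. real (count_list js i) < K} \<le>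
    4 * t * (z - 1)^2 * (1 + (z^2 - 1) / n) ^ t / (n * (1 + (z - 1) / n) ^ t)^2 +
    2 * 2 powr K * ((1 + (z / 2 - 1) / n) / (1 + (z - 1) / n)) ^ t"
proof -
  define M where "M = n * (1 + (z - 1) / n) ^ t"
  define P where "P = hits n t"
  have M: "M > 0" using n z by (simp add: M_def add_pos_nonneg)
  have E: "measure_pmf.expectation P (hit_sum n z) = M"
    by (simp add: P_def M_def expectation_hit_sum[OF n])
  have int: "integrable (measure_pmf P) f" for f :: "_ \<Rightarrow> real" by (simp add: P_def integrable_hits n)
  \<comment> \<open>\<open>A1\<close> is bounded by Chebyshev, \<open>A2\<close> by Markov.\<close>
  define A1 where "A1 = {js. M / 2 \<le> \<bar>hit_sum n z js - M\<bar>}"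
  define A2 where "A2 = {js. M / (2 * 2 powr K) \<le> hit_sum n (z / 2) js}"
  have "js \<in> A1 \<union> A2" if "\<forall>i<n. real (count_list js i) < K" for js
  proof (rule ccontr)
    assume "js \<notin> A1 \<union> A2"
    then have "\<bar>hit_sum n z js - M\<bar> < M / 2" and 2: "hit_sum n (z / 2) js < M / (2 * 2 powr K)"
      unfolding A1_def A2_def by (simp_all add: not_le)
    then have 1: "hit_sum n z js > M / 2" by linarith
    have "z ^ count_list js i \<le> 2 powr K * (z / 2) ^ count_list js i" if "i < n" for i
    proof -
      have "2 ^ count_list js i = 2 powr real (count_list js i)" by (simp add: powr_realpow)
      also have "\<dots> \<le> 2 powr K" using \<open>\<forall>i<n. _\<close> that by (intro powr_mono) (auto intro: less_imp_le)
      finally have "2 ^ count_list js i * (z / 2) ^ count_list js i \<le> 2 powr K * (z / 2) ^ count_list js i"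
        using z by (intro mult_right_mono) auto
      then show ?thesis by (simp add: power_mult_distrib[symmetric])
    qed
    then have "hit_sum n z js \<le> 2 powr K * hit_sum n (z / 2) js"
      unfolding hit_sum_def sum_distrib_left by (intro sum_mono) auto
    also have "\<dots> < 2 powr K * (M / (2 * 2 powr K))" using 2 by (intro mult_strict_left_mono) auto
    also have "\<dots> = M / 2" by simp
    finally show False using 1 by simp
  qed
  then have "measure_pmf.prob P {js. \<forall>i<n. real (count_list js i) < K} \<le> measure_pmf.prob P (A1 \<union> A2)"
    by (intro measure_pmf.finite_measure_mono) auto
  also have "\<dots> \<le> measure_pmf.prob P A1 + measure_pmf.prob P A2"
    by (intro measure_Un_le) auto
  also have "measure_pmf.prob P A1 \<le> measure_pmf.variance P (hit_sum n z) / (M / 2)^2"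
    using measure_pmf.Chebyshev_inequality[of "hit_sum n z" P "M / 2"] M int by (simp add: A1_def E)
  also have "measure_pmf.variance P (hit_sum n z) = measure_pmf.expectation P (\<lambda>js. (hit_sum n z js)^2) - M^2"
    using int by (subst measure_pmf.variance_eq) (simp_all add: E)
  also have "(measure_pmf.expectation P (\<lambda>js. (hit_sum n z js)^2) - M^2) / (M / 2)^2 \<le>
      (t * (z - 1)^2 * (1 + (z^2 - 1) / n) ^ t) / (M / 2)^2"
    using expectation_hit_sum_sq[OF n, of z t] z by (intro divide_right_mono) (auto simp: M_def P_def)
  also have "measure_pmf.prob P A2 \<le> measure_pmf.expectation P (hit_sum n (z / 2)) / (M / (2 * 2 powr K))"
    using integral_Markov_inequality_measure[of "measure_pmf P" "hit_sum n (z / 2)" UNIV "M / (2 * 2 powr K)"] M int hit_sum_nonneg[of "z / 2" n] z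
    by (simp add: A2_def)
  also have "\<dots> = 2 * 2 powr K * ((1 + (z / 2 - 1) / n) / (1 + (z - 1) / n)) ^ t"
    unfolding P_def expectation_hit_sum[OF n] using n by (simp add: M_def power_divide)
  also have "t * (z - 1)^2 * (1 + (z^2 - 1) / n) ^ t / (M / 2)^2 = 4 * t * (z - 1)^2 * (1 + (z^2 - 1) / n) ^ t / M^2"
    by (simp add: power_divide)
  finally show ?thesis unfolding P_def M_def by simp
qed

text \<open>Both terms of \<open>prob_few_hits\<close> tend to 0 at the threshold
  \<open>k / 2 * ln n\<close>, which is at least \<open>q / 4 * ln n\<close>.\<close>

lemma eventually_prob_few_hits:
  fixes q :: real
  assumes q: "0 < q" "q \<le> 1/4"
  shows "\<forall>\<^sub>F n in sequentially.
    measure_pmf.prob (hits n (nat \<lceil>q^2 * n * ln n\<rceil>)) {js. \<forall>i<n. real (count_list js i) < q / 4 * ln n} \<le> 1 / 4"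
proof -
  \<comment> \<open>Chosen for \<open>c * q^2 = 1/4\<close>: the Chebyshev term is then of order
    \<open>n powr (-3/4) * ln n\<close>.\<close>
  define z where "z = 1 + 1 / (2 * q)"
  define c where "c = (z - 1)^2"
  \<comment> \<open>Under the tilt by \<open>z\<close>, a bin typically has about
    \<open>k * ln n\<close> hits.\<close>
  define k where "k = q^2 * z"
  have z: "z \<ge> 2" using q by (simp add: z_def field_simps)
  have cq: "c * q^2 = 1/4" using q by (simp add: c_def z_def power2_eq_square)
  have c: "c > 0" using z by (simp add: c_def)
  have "k = q^2 + q / 2" using q by (simp add: k_def z_def power2_eq_square field_simps)
  then have k: "k \<ge> q / 2" "k > 0" using q by (simp_all add: add_pos_pos)
  have lim: "((\<lambda>n. 4 * (q^2 * real n * ln (real n) + 1) * c * exp (ln (real n) / 4 + c / real n) / (real n)^2 +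
      2 * exp (- (k / 10) * ln (real n))) \<longlongrightarrow> 0) at_top"
  proof -
    have "((\<lambda>n. 4 * (q^2 * real n * ln (real n) + 1) * c * exp (ln (real n) / 4 + c / real n) / (real n)^2) \<longlongrightarrow> 0) at_top"
      using q c by real_asymp
    moreover have "((\<lambda>n. 2 * exp (- (k / 10) * ln (real n))) \<longlongrightarrow> 0) at_top"
      using k by real_asymp
    ultimately show ?thesis using tendsto_add[of _ 0 _ _ 0] by fastforce
  qed
  have ev: "\<forall>\<^sub>F n in sequentially. 4 * (q^2 * real n * ln (real n) + 1) * c * exp (ln (real n) / 4 + c / real n) / (real n)^2 +
      2 * exp (- (k / 10) * ln (real n)) < 1/4"
    by (rule order_tendstoD(2)[OF lim]) simp
  show ?thesis
    using ev eventually_ge_at_top[of 1] eventually_ge_at_top[of "nat \<lceil>9 * z\<rceil>"]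
  proof eventually_elim
    case (elim n)
    define t where "t = nat \<lceil>q^2 * n * ln n\<rceil>"
    define l where "l = ln (real n)"
    define a where "a = 1 + (z - 1) / n"
    have n: "n > 0" "real n \<ge> 9 * z" using elim by linarith+
    have l: "l \<ge> 0" using n by (simp add: l_def)
    have "q^2 * n * l \<ge> 0" using l by simp
    then have t: "real t \<ge> q^2 * n * l" "real t \<le> q^2 * n * l + 1"
      unfolding t_def l_def by linarith+
    have a: "a \<ge> 1" using z by (simp add: a_def)
    have 1: "4 * real t * (z - 1)^2 * (1 + (z^2 - 1) / n) ^ t / (n * a ^ t)^2 \<le>
       4 * (q^2 * n * l + 1) * c * exp (l / 4 + c / n) / (real n)^2"
    proof -
      \<comment> \<open>Since \<open>(z^2 - 1) - 2 * (z - 1) = c\<close>, the powers of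
        \<open>a\<close> will cancel against the squared mean.\<close>
      have "1 + (z^2 - 1) / n \<le> a^2 + c / n"
      proof -
        have "a^2 + c / n - (1 + (z^2 - 1) / n) = ((z - 1) / n)^2"
          using n by (simp add: a_def c_def power2_eq_square field_simps)
        then show ?thesis using zero_le_power2[of "(z - 1) / n"] by linarith
      qed
      also have "\<dots> \<le> a^2 * (1 + c / n)"
      proof -
        have "1 * (c / n) \<le> a^2 * (c / n)" using a c by (intro mult_right_mono) (auto simp: one_le_power)
        then show ?thesis by (simp add: algebra_simps)
      qed
      also have "\<dots> \<le> a^2 * exp (c / n)" by (intro mult_left_mono exp_ge_add_one_self) auto
      finally have "1 + (z^2 - 1) / n \<le> a^2 * exp (c / n)" .
      then have "(1 + (z^2 - 1) / n) ^ t \<le> (a^2 * exp (c / n)) ^ t"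
        using z by (intro power_mono) (auto simp: one_le_power add_nonneg_nonneg)
      also have "\<dots> = (a ^ t)^2 * exp (t * (c / n))"
        by (simp add: power_mult_distrib exp_of_nat_mult[symmetric] power_mult[symmetric] mult.commute)
      also have "\<dots> \<le> (a ^ t)^2 * exp (l / 4 + c / n)"
      proof -
        have "t * (c / n) \<le> (q^2 * n * l + 1) * (c / n)" using t c by (intro mult_right_mono) auto
        also have "\<dots> = (c * q^2) * l + c / n" using n by (simp add: field_simps)
        finally show ?thesis using cq by (intro mult_left_mono) auto
      qed
      finally have "(1 + (z^2 - 1) / n) ^ t \<le> (a ^ t)^2 * exp (l / 4 + c / n)" .
      then have "4 * real t * (z - 1)^2 * (1 + (z^2 - 1) / n) ^ t / (n * a ^ t)^2 \<le>
        4 * (q^2 * n * l + 1) * c * ((a ^ t)^2 * exp (l / 4 + c / n)) / (n * a ^ t)^2"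
        using t c l z unfolding c_def[symmetric]
        by (intro divide_right_mono mult_mono) (auto simp: one_le_power add_nonneg_nonneg)
      also have "\<dots> = 4 * (q^2 * n * l + 1) * c * exp (l / 4 + c / n) / (real n)^2"
        using a by (simp add: power_mult_distrib)
      finally show ?thesis .
    qed
    have 2: "2 * 2 powr (k / 2 * l) * ((1 + (z / 2 - 1) / n) / a) ^ t \<le> 2 * exp (- (k / 10) * l)"
    proof -
      \<comment> \<open>The factor \<open>10 / 9\<close> comes from \<open>n \<ge> 9 * z\<close> and
        leads to the exponent \<open>9 / 20 * k * l\<close>.\<close>
      have den: "n + z - 1 > 0" "n + z - 1 \<le> 10 / 9 * n" using n z by auto
      have "(1 + (z / 2 - 1) / n) / a = 1 - (z / 2) / (n + z - 1)"
      proof -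
        have "a = (n + z - 1) / n" "1 + (z / 2 - 1) / n = ((n + z - 1) - z / 2) / n"
          using n by (simp_all add: a_def field_simps)
        then have "(1 + (z / 2 - 1) / n) / a = ((n + z - 1) - z / 2) / (n + z - 1)"
          using n by simp
        also have "\<dots> = 1 - (z / 2) / (n + z - 1)"
          using den by (subst diff_divide_distrib) simp
        finally show ?thesis .
      qed
      also have "\<dots> \<le> 1 - (z / 2) / (10 / 9 * n)"
        using den z n by (intro diff_left_mono divide_left_mono) auto
      also have "\<dots> \<le> exp (- (9 / 20 * z / n))"
        using exp_ge_add_one_self[of "- (9 / 20 * z / n)"] n by (simp add: field_simps)
      finally have "((1 + (z / 2 - 1) / n) / a) ^ t \<le> exp (- (9 / 20 * z / n)) ^ t"
        using n z a by (intro power_mono) (auto intro!: divide_nonneg_nonneg add_nonneg_nonneg)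
      also have "\<dots> = exp (- (9 / 20 * z / n * t))"
        by (simp add: exp_of_nat_mult[symmetric] mult.commute)
      also have "\<dots> \<le> exp (- (9 / 20 * k * l))"
      proof -
        have "9 / 20 * z / n * (q^2 * n * l) \<le> 9 / 20 * z / n * t"
          using t z by (intro mult_left_mono) auto
        then show ?thesis using n by (simp add: k_def mult_ac)
      qed
      finally have A: "((1 + (z / 2 - 1) / n) / a) ^ t \<le> exp (- (9 / 20 * k * l))" .
      \<comment> \<open>This puts the exponent \<open>7 / 20 * k * l\<close> of the threshold below
        \<open>9 / 20 * k * l\<close>; the margin is \<open>k / 10 * l\<close>.\<close>
      have "ln 2 \<le> (7 / 10 :: real)" using ln_2_less_1 ln2_le_25_over_36 by simp
      then have "ln 2 * (k / 2 * l) \<le> 7 / 10 * (k / 2 * l)"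
        using k l by (intro mult_right_mono) auto
      then have "2 powr (k / 2 * l) \<le> exp (7 / 20 * k * l)"
        by (simp add: powr_def mult_ac)
      then have "2 powr (k / 2 * l) * ((1 + (z / 2 - 1) / n) / a) ^ t \<le> exp (7 / 20 * k * l) * exp (- (9 / 20 * k * l))"
        using A n z a by (intro mult_mono) (auto intro!: divide_nonneg_nonneg add_nonneg_nonneg)
      also have "\<dots> = exp (- (k / 10) * l)" by (simp add: exp_add[symmetric])
      finally show ?thesis by simp
    qed
    have "q / 4 * l \<le> k / 2 * l" using k l by (intro mult_right_mono) auto
    then have "measure_pmf.prob (hits n t) {js. \<forall>i<n. real (count_list js i) < q / 4 * l} \<le>
      measure_pmf.prob (hits n t) {js. \<forall>i<n. real (count_list js i) < k / 2 * l}"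
      by (intro measure_pmf.finite_measure_mono Collect_mono) (meson less_le_trans, simp)
    also have "\<dots> \<le> 1 / 4"
      using prob_few_hits[OF n(1) z, of t "k / 2 * l"] 1 2 elim(1) unfolding a_def l_def by linarith
    finally show ?case by (simp add: t_def l_def)
  qed
qed

section \<open>Hits against growth in the last window\<close>

theorem theorem3p3:
  "\<exists>\<kappa>::real. \<kappa> > 0 \<and>
     (\<forall>\<^sub>F n::nat in sequentially. \<forall>m::nat. real m \<ge> \<kappa> * real n * ln (real n) \<longrightarrow>
        measure_pmf.prob (packing n m) {x. gap n x \<ge> sqrt \<kappa> / 20 * ln (real n)} \<ge> 1 / 2)"
proof -
  \<comment> \<open>The witness is \<open>\<kappa> = q^2\<close>. With this \<open>q\<close>, four
    times the bound on the expected rise is about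
    \<open>4 * growth * q^2 * ln n = q / 10 * ln n\<close>, well below the
    \<open>q / 4 * ln n\<close> hits.\<close>
  define q where "q = 1 / (40 * growth)"
  have q: "0 < q" "q \<le> 1/4" by (simp_all add: q_def growth_def)
  have gq: "growth * q^2 = q / 40" by (simp add: q_def growth_def power2_eq_square)
  have "\<forall>\<^sub>F n in sequentially. q / 10 * ln (real n) > 8 * growth / real n"
    using q unfolding growth_def by real_asymp
  then have "\<forall>\<^sub>F n::nat in sequentially. \<forall>m::nat. real m \<ge> q^2 * real n * ln (real n) \<longrightarrow>
        measure_pmf.prob (packing n m) {x. gap n x \<ge> sqrt (q^2) / 20 * ln (real n)} \<ge> 1 / 2"
    using eventually_prob_few_hits[OF q] eventually_ge_at_top[of 1000000]
  proof eventually_elim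
    case (elim n)
    show ?case
    proof (intro allI impI)
      fix m :: nat
      assume m: "real m \<ge> q^2 * real n * ln (real n)"
      define t where "t = nat \<lceil>q^2 * n * ln n\<rceil>"
      define s where "s = m - t"
      define l where "l = ln (real n)"
      have n: "n > 0" "n \<ge> 1000000" using elim by simp_all
      have l: "l > 0" using n by (simp add: l_def)
      have nonneg: "q^2 * n * l \<ge> 0" using l by simp
      \<comment> \<open>The integer \<open>m\<close> exceeds a real, hence also its ceiling; so the
        truncated subtraction in \<open>s\<close> is exact.\<close>
      have "\<lceil>q^2 * n * ln n\<rceil> \<le> int m" by (simp only: ceiling_le_iff of_int_of_nat_eq m)
      then have "t \<le> m" unfolding t_def nat_le_iff .
      then have mst: "m = s + t" by (simp add: s_def)
      have t: "real t \<le> q^2 * n * l + 1"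
        using nonneg unfolding t_def l_def by linarith
      define P where "P = pair_pmf (packing n s) (hits n t)"
      define final where "final = (\<lambda>(x, js). run n x js)"
      define rise where "rise = (\<lambda>y. avg_load n (final y) - avg_load n (fst y))"
      \<comment> \<open>Four times the expected rise, for a Markov bound of \<open>1/4\<close>; the
        last summand makes \<open>r\<close> positive.\<close>
      define r where "r = 4 * growth * t / n + 4 * growth / n"
      define bad where "bad = {y. rise y \<ge> r} \<union> {y. \<forall>i<n. real (count_list (snd y) i) < q / 4 * l}"
      have pack: "packing n m = map_pmf final P"
        by (simp add: mst packing_add P_def final_def)
      have fin: "finite (set_pmf P)"
        unfolding P_def using n finite_set_packing finite_set_hits by simp
      have int: "integrable (measure_pmf P) f" for f :: "_ \<Rightarrow> real"
        by (intro integrable_measure_pmf_finite fin)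
      have supp: "set (snd y) \<subseteq> {..<n}" if "y \<in> set_pmf P" for y
        using that n by (auto simp: P_def set_replicate_pmf set_pmf_of_set lessThan_empty_iff)
      have r: "r > 0" using n by (simp add: r_def growth_def add_nonneg_pos)
      have "measure_pmf.prob P {y. rise y \<ge> r} \<le> measure_pmf.expectation P rise / r"
      proof -
        have "AE y in P. 0 \<le> rise y"
          using supp avg_load_run by (fastforce intro!: AE_pmfI simp: rise_def final_def split_beta)
        then show ?thesis
          using integral_Markov_inequality_measure[of "measure_pmf P" rise UNIV r] r int by auto
      qed
      \<comment> \<open>By linearity only the laws at the two ends of the window matter.\<close>
      also have "measure_pmf.expectation P rise =
        measure_pmf.expectation (map_pmf final P) (avg_load n) - measure_pmf.expectation (map_pmf fst P) (avg_load n)"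
        unfolding rise_def by (simp add: int)
      also have "\<dots> = measure_pmf.expectation (packing n (s + t)) (avg_load n) - measure_pmf.expectation (packing n s) (avg_load n)"
        by (simp only: pack[symmetric] mst) (simp add: P_def map_fst_pair_pmf)
      also have "\<dots> \<le> growth * t / n" using expectation_avg_load_add[OF n(2), of s t] by simp
      also have "growth * t / n / r \<le> 1/4"
      proof -
        have "growth * t / n \<le> 1/4 * r" by (simp add: r_def growth_def)
        then show ?thesis using pos_divide_le_eq[OF r] by blast
      qed
      finally have 1: "measure_pmf.prob P {y. rise y \<ge> r} \<le> 1/4"
        using r by (simp add: divide_right_mono)
      have "measure_pmf.prob P {y. \<forall>i<n. real (count_list (snd y) i) < q / 4 * l} =
        measure_pmf.prob (map_pmf snd P) {js. \<forall>i<n. real (count_list js i) < q / 4 * l}"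
        by (simp add: vimage_def)
      also have "map_pmf snd P = hits n t" by (simp add: P_def map_snd_pair_pmf)
      finally have 2: "measure_pmf.prob P {y. \<forall>i<n. real (count_list (snd y) i) < q / 4 * l} \<le> 1/4"
        using elim(2) by (simp add: t_def l_def)
      have "measure_pmf.prob P bad \<le> 1/4 + 1/4"
        unfolding bad_def using 1 2
        by (intro order_trans[OF measure_Un_le] add_mono) auto
      then have "1 / 2 \<le> measure_pmf.prob P (- bad)"
        using measure_pmf.prob_compl[of bad P] by (simp add: Compl_eq_Diff_UNIV)
      also have "\<dots> \<le> measure_pmf.prob P {y. gap n (final y) \<ge> q / 20 * l}"
      proof (intro measure_pmf.finite_measure_mono_AE AE_pmfI impI)
        fix y assume y: "y \<in> set_pmf P" "y \<in> - bad"
        obtain x js where xj: "y = (x, js)" by force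
        obtain i where i: "i < n" "real (count_list js i) \<ge> q / 4 * l" and rise: "rise y < r"
          using y(2) xj by (auto simp: bad_def not_less not_le)
        have "q / 4 * l > 0" using q l by simp
        then have "count_list js i > 0" using i(2) by linarith
        then have "gap n (final y) \<ge> count_list js i - rise y"
          using gap_run_ge[of js n i x] supp[OF y(1)] i by (simp add: xj final_def rise_def)
        \<comment> \<open>Rounding \<open>t\<close> up and the last summand of \<open>r\<close> cost
          \<open>4 * growth / n\<close> each, together at most \<open>q / 10 * l\<close>. Then
          \<open>q / 4 - q / 5 = q / 20\<close> is left for the gap.\<close>
        moreover have "r \<le> q / 5 * l"
        proof -
          have "4 * growth * t / n \<le> 4 * growth * (q^2 * n * l + 1) / n"
            using t by (intro divide_right_mono mult_left_mono) (auto simp: growth_def)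
          also have "\<dots> = 4 * (growth * q^2) * l + 4 * growth / n" using n by (simp add: field_simps)
          finally have "r \<le> q / 10 * l + 8 * growth / n" unfolding gq r_def by simp
          then show ?thesis using elim(1) by (simp add: l_def)
        qed
        ultimately have "gap n (final y) \<ge> q / 20 * l" using i(2) rise by simp
        then show "y \<in> {y. gap n (final y) \<ge> q / 20 * l}" by simp
      qed auto
      also have "\<dots> = measure_pmf.prob (packing n m) {x. gap n x \<ge> sqrt (q^2) / 20 * ln (real n)}"
        using q by (simp add: pack vimage_def l_def)
      finally show "1 / 2 \<le> measure_pmf.prob (packing n m) {x. gap n x \<ge> sqrt (q^2) / 20 * ln (real n)}" .
    qed
  qed
  then show ?thesis using q by (intro exI[of _ "q^2"]) auto
qed

end
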